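(* Each of the six conjugacy relations $\sim_o$, $\sim_c$, $\sim_n$, $\sim_p$, $\sim_{p^*}$ and $\sim_{tr}$ is partition-covering. That is, for each $\sim\ \in\{\sim_o,\sim_c,\sim_n,\sim_p,\sim_{p^*},\sim_{tr}\}$, every set $X$ and every partition $P$ of $X$, there exists a semigroup with universe $X$ (for $\sim_{tr}$, a semigroup on which $\sim_{tr}$ is defined, i.e. an epigroup) on which $\sim$ is an equivalence relation whose set of equivalence classes is exactly $P$.
   Context: For a semigroup $S$, $S^1$ denotes $S$ with an identity element adjoined if $S$ has none (and $S^1=S$ otherwise). For $a,b\in S$: - $a\sim_o b$ iff there exist $g,h\in S$ with $ag=gb$ and $bh=ha$. - If $S$ has a zero element $0$ (i.e. $0s=s0=0$ for all $s\in S$) and $a\in S\setminus\{0\}$, let $\mathbb{P}(a)=\{g\in S : (ma)g\neq 0 \text{ for every } ma\in S^1a\setminus\{0\}\}$, and put $\mathbb{P}(0)=\{0\}$; if $S$ has no zero element, $\mathbb{P}(a)=S$ for all $a$. Let $\mathbb{P}^1(a)=\mathbb{P}(a)\cup\{1\}$ where $1$ is the identity of $S^1$. Then $a\sim_c b$ iff there exist $g\in\mathbb{P}^1(a)$ and $h\in\mathbb{P}^1(b)$ with $ag=gb$ and $bh=ha$. - $a\sim_n b$ iff there exist $g,h\in S^1$ with $ag=gb$, $bh=ha$, $hag=b$ and $gbh=a$. - $a\sim_p b$ iff there exist $u,v\in S$ with $a=uv$ and $b=vu$. - $\sim_{p^*}$ is the transitive closure of $\sim_p$. - An epigroup is a semigroup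 in which every element has a power lying in a subgroup; in an epigroup, $s^\omega$ denotes the idempotent power of $s$ and $s^{\omega+1}=s^\omega s$. If $S$ is an epigroup, $a\sim_{tr} b$ iff there exist $g,h\in S^1$ with $ghg=g$, $hgh=h$, $hg=a^\omega$, $gh=b^\omega$ and $ga^{\omega+1}h=b^{\omega+1}$. *)

theory Defs
  imports "HOL-Library.Disjoint_Sets" "HOL-Algebra.Group"
begin

text \<open>A semigroup is given by a universe \<open>S\<close> and an operation \<open>m\<close>, of which only the
  values on \<open>S\<close> matter. The empty semigroup is not excluded.\<close>

definition semigroup_on :: "'a set \<Rightarrow> ('a \<Rightarrow> 'a \<Rightarrow> 'a) \<Rightarrow> bool" where
  "semigroup_on S m \<longleftrightarrow>
     (\<forall>x\<in>S. \<forall>y\<in>S. m x y \<in> S) \<and> (\<forall>x\<in>S. \<forall>y\<in>S. \<forall>z\<in>S. m (m x y) z = m x (m y z))"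

definition is_identity :: "'a set \<Rightarrow> ('a \<Rightarrow> 'a \<Rightarrow> 'a) \<Rightarrow> 'a \<Rightarrow> bool" where
  "is_identity S m e \<longleftrightarrow> e \<in> S \<and> (\<forall>x\<in>S. m e x = x \<and> m x e = x)"

definition is_zero :: "'a set \<Rightarrow> ('a \<Rightarrow> 'a \<Rightarrow> 'a) \<Rightarrow> 'a \<Rightarrow> bool" where
  "is_zero S m z \<longleftrightarrow> z \<in> S \<and> (\<forall>x\<in>S. m z x = z \<and> m x z = z)"

text \<open>The semigroup \<open>S\<^sup>1\<close> lives on the type \<open>'a option\<close>: an element \<open>x\<close> of \<open>S\<close> is
  represented by \<open>Some x\<close>, and \<open>None\<close> is the adjoined identity, which belongs to \<open>S\<^sup>1\<close> only
  if \<open>S\<close> has no identity of its own.\<close>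

definition adj_one :: "'a set \<Rightarrow> ('a \<Rightarrow> 'a \<Rightarrow> 'a) \<Rightarrow> 'a option set" where
  "adj_one S m = (if \<exists>e. is_identity S m e then Some ` S else insert None (Some ` S))"

fun mult1 :: "('a \<Rightarrow> 'a \<Rightarrow> 'a) \<Rightarrow> 'a option \<Rightarrow> 'a option \<Rightarrow> 'a option" where
  "mult1 m (Some x) (Some y) = Some (m x y)"
| "mult1 m None v = v"
| "mult1 m u None = u"

definition one1 :: "'a set \<Rightarrow> ('a \<Rightarrow> 'a \<Rightarrow> 'a) \<Rightarrow> 'a option" where
  "one1 S m = (THE u. is_identity (adj_one S m) (mult1 m) u)"

lemma is_identity_unique: "is_identity S m e \<Longrightarrow> is_identity S m f \<Longrightarrow> e = f"
  unfolding is_identity_def by metis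

lemma one1_is_identity: "is_identity (adj_one S m) (mult1 m) (one1 S m)"
proof -
  have "\<exists>u. is_identity (adj_one S m) (mult1 m) u"
  proof (cases "\<exists>e. is_identity S m e")
    case True
    then obtain e where "is_identity S m e" by blast
    then have "is_identity (adj_one S m) (mult1 m) (Some e)"
      using True by (auto simp: is_identity_def adj_one_def)
    then show ?thesis ..
  next
    case False
    then have "is_identity (adj_one S m) (mult1 m) None"
      by (simp add: is_identity_def[of _ "mult1 m"] adj_one_def)
    then show ?thesis ..
  qed
  then show ?thesis
    unfolding one1_def by (metis is_identity_unique theI)
qed


subsection \<open>Conjugacy relations\<close>

definition sim_o :: "'a set \<Rightarrow> ('a \<Rightarrow> 'a \<Rightarrow> 'a) \<Rightarrow> 'a rel" where
  "sim_o S m = {(a, b). a \<in> S \<and> b \<in> S \<and>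
     (\<exists>g\<in>S. \<exists>h\<in>S. m a g = m g b \<and> m b h = m h a)}"

definition left_ideal1 :: "'a set \<Rightarrow> ('a \<Rightarrow> 'a \<Rightarrow> 'a) \<Rightarrow> 'a \<Rightarrow> 'a set" where
  "left_ideal1 S m a = {x. \<exists>u\<in>adj_one S m. mult1 m u (Some a) = Some x}"

definition PP :: "'a set \<Rightarrow> ('a \<Rightarrow> 'a \<Rightarrow> 'a) \<Rightarrow> 'a \<Rightarrow> 'a set" where
  "PP S m a =
     (if \<exists>z. is_zero S m z then
        (if is_zero S m a then {a}
         else {g \<in> S. \<forall>x\<in>left_ideal1 S m a. \<not> is_zero S m x \<longrightarrow> \<not> is_zero S m (m x g)})
      else S)"

definition PP1 :: "'a set \<Rightarrow> ('a \<Rightarrow> 'a \<Rightarrow> 'a) \<Rightarrow> 'a \<Rightarrow> 'a option set" where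
  "PP1 S m a = Some ` PP S m a \<union> {one1 S m}"

definition sim_c :: "'a set \<Rightarrow> ('a \<Rightarrow> 'a \<Rightarrow> 'a) \<Rightarrow> 'a rel" where
  "sim_c S m = {(a, b). a \<in> S \<and> b \<in> S \<and>
     (\<exists>g\<in>PP1 S m a. \<exists>h\<in>PP1 S m b.
        mult1 m (Some a) g = mult1 m g (Some b) \<and>
        mult1 m (Some b) h = mult1 m h (Some a))}"

definition sim_n :: "'a set \<Rightarrow> ('a \<Rightarrow> 'a \<Rightarrow> 'a) \<Rightarrow> 'a rel" where
  "sim_n S m = {(a, b). a \<in> S \<and> b \<in> S \<and>
     (\<exists>g\<in>adj_one S m. \<exists>h\<in>adj_one S m.
        mult1 m (Some a) g = mult1 m g (Some b) \<and>
        mult1 m (Some b) h = mult1 m h (Some a) \<and>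
        mult1 m (mult1 m h (Some a)) g = Some b \<and>
        mult1 m (mult1 m g (Some b)) h = Some a)}"

definition sim_p :: "'a set \<Rightarrow> ('a \<Rightarrow> 'a \<Rightarrow> 'a) \<Rightarrow> 'a rel" where
  "sim_p S m = {(a, b). a \<in> S \<and> b \<in> S \<and> (\<exists>u\<in>S. \<exists>v\<in>S. a = m u v \<and> b = m v u)}"

definition sim_p_star :: "'a set \<Rightarrow> ('a \<Rightarrow> 'a \<Rightarrow> 'a) \<Rightarrow> 'a rel" where
  "sim_p_star S m = (sim_p S m)\<^sup>+"


subsection \<open>Epigroups and trace conjugacy\<close>

definition subgroup_with :: "'a set \<Rightarrow> ('a \<Rightarrow> 'a \<Rightarrow> 'a) \<Rightarrow> 'a set \<Rightarrow> 'a \<Rightarrow> bool" where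
  "subgroup_with S m G e \<longleftrightarrow> G \<subseteq> S \<and> group \<lparr>carrier = G, mult = m, one = e\<rparr>"

text \<open>\<open>spow m s n\<close> is the positive power of \<open>s\<close> with exponent \<open>n + 1\<close>.\<close>

primrec spow :: "('a \<Rightarrow> 'a \<Rightarrow> 'a) \<Rightarrow> 'a \<Rightarrow> nat \<Rightarrow> 'a" where
  "spow m s 0 = s"
| "spow m s (Suc n) = m (spow m s n) s"

definition epigroup :: "'a set \<Rightarrow> ('a \<Rightarrow> 'a \<Rightarrow> 'a) \<Rightarrow> bool" where
  "epigroup S m \<longleftrightarrow> semigroup_on S m \<and>
     (\<forall>s\<in>S. \<exists>n G e. subgroup_with S m G e \<and> spow m s n \<in> G)"

text \<open>In an epigroup \<open>s\<^sup>\<omega>\<close> is the identity of the subgroups that contain a power of \<open>s\<close>. It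
  does not depend on the choices (\<open>omega_eqI\<close>) and it is the idempotent power of \<open>s\<close> whenever
  there is one (\<open>omega_idempotent_power\<close>); in a non-periodic epigroup, such as the additive
  group of the integers, an element need not have an idempotent power.\<close>

definition omega :: "'a set \<Rightarrow> ('a \<Rightarrow> 'a \<Rightarrow> 'a) \<Rightarrow> 'a \<Rightarrow> 'a" where
  "omega S m s = (THE e. \<exists>n G. subgroup_with S m G e \<and> spow m s n \<in> G)"

definition sim_tr :: "'a set \<Rightarrow> ('a \<Rightarrow> 'a \<Rightarrow> 'a) \<Rightarrow> 'a rel" where
  "sim_tr S m = {(a, b). a \<in> S \<and> b \<in> S \<and>
     (\<exists>g\<in>adj_one S m. \<exists>h\<in>adj_one S m.
        mult1 m (mult1 m g h) g = g \<and>
        mult1 m (mult1 m h g) h = h \<and>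
        mult1 m h g = Some (omega S m a) \<and>
        mult1 m g h = Some (omega S m b) \<and>
        mult1 m (mult1 m g (Some (m (omega S m a) a))) h = Some (m (omega S m b) b))}"

lemma spow_closed: "semigroup_on S m \<Longrightarrow> s \<in> S \<Longrightarrow> spow m s n \<in> S"
  by (induction n) (auto simp: semigroup_on_def)

lemma spow_mult:
  assumes "semigroup_on S m" "s \<in> S"
  shows "m (spow m s i) (spow m s j) = spow m s (Suc (i + j))"
  using spow_closed[OF assms] assms
  by (induction j) (simp_all add: semigroup_on_def, metis)

lemma spow_spow:
  assumes "semigroup_on S m" "s \<in> S"
  shows "spow m (spow m s i) j = spow m s (i + j + i * j)"
proof (induction j)
  case (Suc j)
  then show ?case
    using spow_mult[OF assms, of "i + j + i * j" i] by (simp only: spow.simps(2)[of m "spow m s i"]) (simp add: algebra_simps)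
qed simp

lemma spow_in_subgroup:
  assumes "subgroup_with S m G e" "x \<in> G"
  shows "spow m x n \<in> G"
proof -
  interpret group "\<lparr>carrier = G, mult = m, one = e\<rparr>"
    using assms(1) by (simp add: subgroup_with_def)
  show ?thesis
    using m_closed assms(2) by (induction n) auto
qed

lemma omega_eqI:
  assumes S: "semigroup_on S m" "s \<in> S" and G: "subgroup_with S m G e" "spow m s n \<in> G"
  shows "omega S m s = e"
  unfolding omega_def
proof (rule the_equality)
  show "\<exists>n G. subgroup_with S m G e \<and> spow m s n \<in> G" using G by blast
next
  fix f assume "\<exists>k H. subgroup_with S m H f \<and> spow m s k \<in> H"
  then obtain k H where H: "subgroup_with S m H f" "spow m s k \<in> H" by blast
  define x where "x = spow m s (n + k + n * k)"
  have xG: "x \<in> G"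
    using spow_in_subgroup[OF G, of k] by (simp add: x_def spow_spow[OF S])
  have xH: "x \<in> H"
    using spow_in_subgroup[OF H, of n] by (simp add: x_def spow_spow[OF S] algebra_simps)
  interpret G: group "\<lparr>carrier = G, mult = m, one = e\<rparr>"
    using G(1) by (simp add: subgroup_with_def)
  interpret H: group "\<lparr>carrier = H, mult = m, one = f\<rparr>"
    using H(1) by (simp add: subgroup_with_def)
  obtain y where y: "y \<in> G" "m x y = e" using G.r_inv_ex xG by auto
  obtain z where z: "z \<in> H" "m z x = f" using H.l_inv_ex xH by auto
  have GS: "G \<subseteq> S" and HS: "H \<subseteq> S" using G H by (auto simp: subgroup_with_def)
  have fx: "m f x = x" using H.l_one xH by simp
  have xe: "m x e = x" using G.r_one xG by simp
  have eG: "e \<in> G" and fH: "f \<in> H" using G.one_closed H.one_closed by auto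
  have "m f e = e"
    using S(1) GS HS fH xG y fx unfolding semigroup_on_def by (metis subsetD)
  moreover have "m f e = f"
    using S(1) GS HS eG xH z xe unfolding semigroup_on_def by (metis subsetD)
  ultimately show "f = e" by simp
qed

lemma omega_idempotent_power:
  assumes S: "semigroup_on S m" "s \<in> S" and e: "e = spow m s n" "m e e = e"
  shows "omega S m s = e"
proof -
  have "group \<lparr>carrier = {e}, mult = m, one = e\<rparr>"
    by (rule groupI) (auto simp: e(2))
  then have "subgroup_with S m {e} e"
    using spow_closed[OF S, of n] e(1) by (simp add: subgroup_with_def)
  then show ?thesis using omega_eqI[OF S] e(1) by blast
qed


subsection \<open>Partition-covering relations\<close>

text \<open>\<open>K\<close> is the class of semigroups on which the relation \<open>R\<close> is defined.\<close>

definition partition_covering ::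
    "('a set \<Rightarrow> ('a \<Rightarrow> 'a \<Rightarrow> 'a) \<Rightarrow> bool) \<Rightarrow> ('a set \<Rightarrow> ('a \<Rightarrow> 'a \<Rightarrow> 'a) \<Rightarrow> 'a rel) \<Rightarrow> bool" where
  "partition_covering K R \<longleftrightarrow>
     (\<forall>X P. partition_on X P \<longrightarrow>
        (\<exists>m. K X m \<and> equiv X (R X m) \<and> X // R X m = P))"

end

theory Submission
  imports Defs "HOL-Algebra.Free_Abelian_Groups"
begin

text \<open>Let \<open>\<pi>\<close> send a point of \<open>X\<close> to its block. Two semigroups on \<open>X\<close>, both built from an
  operation on the set \<open>P\<close> of blocks, serve all six relations.

  For \<open>\<sim>\<^sub>n\<close>, \<open>\<sim>\<^sub>p\<close>, \<open>\<sim>\<^sub>p\<^sub>*\<close> and \<open>\<sim>\<^sub>t\<^sub>r\<close>, order \<open>P\<close> linearly and make \<open>X\<close> the chain of the blocks, each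
  of them a left zero semigroup: a product is its leftmost factor in the lowest block that
  occurs. This is a band, so it is an epigroup with \<open>s\<^sup>\<omega> = s\<close>. For \<open>a\<close> and \<open>b\<close> in one block,
  \<open>a = ab\<close> and \<open>b = ba\<close>, and the elements \<open>a\<close> and \<open>b\<close> themselves witness all four conjugacies.
  Conversely the block of a product is the lowest of the blocks of its factors, whatever their
  order. Elements conjugate under \<open>\<sim>\<^sub>p\<close> or \<open>\<sim>\<^sub>t\<^sub>r\<close> are products of the same two factors, and elements
  conjugate under \<open>\<sim>\<^sub>n\<close> are multiples of each other; so they share a block
  (\<open>left_zero_chain_covers\<close>). As \<open>\<sim>\<^sub>p\<close> is already transitive, \<open>\<sim>\<^sub>p\<^sub>*\<close> agrees with it.

  In that chain \<open>\<sim>\<^sub>o\<close> may be too large, as an element \<open>g\<close> far down satisfies \<open>ag = gb\<close> for all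
  \<open>a\<close> and \<open>b\<close> above it. What is wanted is a semigroup structure on \<open>P\<close> in which \<open>ag = gb\<close> forces
  \<open>a = b\<close>, and a commutative cancellative one will do. It exists on every set: integers modulo
  \<open>n\<close> on a finite one, and on an infinite set the symmetric difference of its finite subsets,
  of which there are as many as elements (\<open>exists_comm_cancel_semigroup\<close>). Choosing a
  representative in each block lifts it to an operation on \<open>X\<close> whose products depend only on the
  blocks of the factors (\<open>inflation_covers\<close>).

  Without a zero, \<open>\<sim>\<^sub>c\<close> is the reflexive closure of \<open>\<sim>\<^sub>o\<close>, so the inflation also serves \<open>\<sim>\<^sub>c\<close> as
  long as it has no zero. It has one exactly when there is a single block; then the left zero
  semigroup takes its place (\<open>sim_c_covers\<close>).\<close>

section \<open>Relations whose classes are the fibres of a block map\<close>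

lemma partition_block_map:
  fixes X :: "'a set"
  assumes P: "partition_on X P"
  obtains \<pi> :: "'a \<Rightarrow> 'a set" where "equiv X {(a, b). a \<in> X \<and> b \<in> X \<and> \<pi> a = \<pi> b}"
    "X // {(a, b). a \<in> X \<and> b \<in> X \<and> \<pi> a = \<pi> b} = P"
proof -
  define \<pi> where "\<pi> a = (THE B. B \<in> P \<and> a \<in> B)" for a
  have \<pi>_eq: "\<pi> a = B" if "B \<in> P" "a \<in> B" for a B
    unfolding \<pi>_def
  proof (rule the_equality)
    show "C = B" if "C \<in> P \<and> a \<in> C" for C
      using that \<open>B \<in> P\<close> \<open>a \<in> B\<close> partition_onD2[OF P] by (auto dest: disjointD)
  qed (use that in auto)
  have X: "X = \<Union>P"
    using partition_onD1[OF P] .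
  have "{(a, b). \<exists>B\<in>P. a \<in> B \<and> b \<in> B} = {(a, b). a \<in> X \<and> b \<in> X \<and> \<pi> a = \<pi> b}"
    using \<pi>_eq unfolding X by auto
  with that[of \<pi>] equiv_partition_on[OF P] partition_on_eq_quotient[OF P] show thesis
    by simp
qed

lemma partition_coveringI:
  fixes K :: "'a set \<Rightarrow> ('a \<Rightarrow> 'a \<Rightarrow> 'a) \<Rightarrow> bool"
  assumes "\<And>X (\<pi> :: 'a \<Rightarrow> 'a set).
    \<exists>m. K X m \<and> R X m = {(a, b). a \<in> X \<and> b \<in> X \<and> \<pi> a = \<pi> b}"
  shows "partition_covering K R"
  unfolding partition_covering_def
proof (intro allI impI)
  fix X :: "'a set" and P
  assume "partition_on X P"
  then obtain \<pi> :: "'a \<Rightarrow> 'a set" where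
    "equiv X {(a, b). a \<in> X \<and> b \<in> X \<and> \<pi> a = \<pi> b}"
    "X // {(a, b). a \<in> X \<and> b \<in> X \<and> \<pi> a = \<pi> b} = P"
    by (rule partition_block_map)
  moreover obtain m where "K X m" "R X m = {(a, b). a \<in> X \<and> b \<in> X \<and> \<pi> a = \<pi> b}"
    using assms[where ?\<pi> = \<pi>] by blast
  ultimately show "\<exists>m. K X m \<and> equiv X (R X m) \<and> X // R X m = P"
    by auto
qed


section \<open>Chains of left zero semigroups\<close>

lemma band_subgroup:
  assumes "s \<in> S" "m s s = s"
  shows "subgroup_with S m {s} s"
proof -
  have "group \<lparr>carrier = {s}, mult = m, one = s\<rparr>"
    by (rule groupI) (auto simp: assms)
  then show ?thesis
    using assms by (simp add: subgroup_with_def)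
qed

lemma band_epigroup:
  assumes "semigroup_on S m" "\<And>s. s \<in> S \<Longrightarrow> m s s = s"
  shows "epigroup S m"
  unfolding epigroup_def
proof (intro conjI ballI)
  fix s assume "s \<in> S"
  then have "subgroup_with S m {s} s \<and> spow m s 0 \<in> {s}"
    using band_subgroup assms(2) by fastforce
  then show "\<exists>n G e. subgroup_with S m G e \<and> spow m s n \<in> G"
    by blast
qed (fact assms(1))

lemma band_omega:
  assumes "semigroup_on S m" "s \<in> S" "m s s = s"
  shows "omega S m s = s"
  using omega_idempotent_power[of S m s s 0] assms by simp

text \<open>The intended \<open>leq\<close> is a linear order; reflexivity makes each fibre of \<open>\<pi>\<close> a left zero
  semigroup.\<close>

definition left_zero_chain :: "('b \<Rightarrow> 'b \<Rightarrow> bool) \<Rightarrow> ('a \<Rightarrow> 'b) \<Rightarrow> 'a \<Rightarrow> 'a \<Rightarrow> 'a" where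
  "left_zero_chain leq \<pi> x y = (if leq (\<pi> x) (\<pi> y) then x else y)"

lemma exists_linear_order:
  obtains leq :: "'b \<Rightarrow> 'b \<Rightarrow> bool" where "\<And>x. leq x x" "\<And>x y. leq x y \<or> leq y x"
    "\<And>x y z. leq x y \<Longrightarrow> leq y z \<Longrightarrow> leq x z" "\<And>x y. leq x y \<Longrightarrow> leq y x \<Longrightarrow> x = y"
proof -
  obtain r :: "'b rel" where "well_order_on UNIV r"
    by (rule exE[OF well_order_on])
  then have lin: "refl r" "trans r" "antisym r" "total r"
    unfolding order_on_defs by blast+
  show thesis
  proof (rule that[of "\<lambda>x y. (x, y) \<in> r"])
    show "(x, x) \<in> r" for x
      using lin(1) by (simp add: reflD)
    show "(x, y) \<in> r \<or> (y, x) \<in> r" for x y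
      using lin(1,4) by (cases "x = y") (auto simp: reflD total_on_def)
    show "(x, z) \<in> r" if "(x, y) \<in> r" "(y, z) \<in> r" for x y z
      using lin(2) that by (rule transD)
    show "x = y" if "(x, y) \<in> r" "(y, x) \<in> r" for x y
      using lin(3) that by (rule antisymD)
  qed
qed

text \<open>Why conjugate elements share a block: \<open>\<pi>\<close> maps products to minima of blocks. So for \<open>\<sim>\<^sub>p\<close> and
  \<open>\<sim>\<^sub>t\<^sub>r\<close>, where \<open>a\<close> and \<open>b\<close> are the two products of one pair of elements, the blocks agree; for
  \<open>\<sim>\<^sub>n\<close>, where each of \<open>a\<close> and \<open>b\<close> is a multiple of the other, each block is below the other. An
  adjoined identity drops out of a product, hence the case distinctions on \<open>g\<close> and \<open>h\<close>.\<close>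

lemma left_zero_chain_covers:
  fixes X :: "'a set" and \<pi> :: "'a \<Rightarrow> 'b"
  obtains m where "epigroup X m"
    "sim_n X m = {(a, b). a \<in> X \<and> b \<in> X \<and> \<pi> a = \<pi> b}"
    "sim_p X m = {(a, b). a \<in> X \<and> b \<in> X \<and> \<pi> a = \<pi> b}"
    "sim_tr X m = {(a, b). a \<in> X \<and> b \<in> X \<and> \<pi> a = \<pi> b}"
proof -
  obtain leq :: "'b \<Rightarrow> 'b \<Rightarrow> bool" where leq: "\<And>x. leq x x" "\<And>x y. leq x y \<or> leq y x"
    "\<And>x y z. leq x y \<Longrightarrow> leq y z \<Longrightarrow> leq x z" "\<And>x y. leq x y \<Longrightarrow> leq y x \<Longrightarrow> x = y"
    using exists_linear_order[where ?'b = 'b] by (metis (full_types))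
  define m where "m = left_zero_chain leq \<pi>"
  note m_def' = m_def left_zero_chain_def
  have sg: "semigroup_on X m"
    unfolding semigroup_on_def
  proof (intro conjI ballI)
    fix x y z
    consider "leq (\<pi> x) (\<pi> y)" "leq (\<pi> y) (\<pi> z)" | "leq (\<pi> x) (\<pi> y)" "\<not> leq (\<pi> y) (\<pi> z)"
      | "\<not> leq (\<pi> x) (\<pi> y)" "leq (\<pi> y) (\<pi> z)" | "\<not> leq (\<pi> x) (\<pi> y)" "\<not> leq (\<pi> y) (\<pi> z)"
      by blast
    then show "m (m x y) z = m x (m y z)"
    proof cases
      case 1
      then show ?thesis
        using leq(3)[of "\<pi> x" "\<pi> y" "\<pi> z"] by (simp add: m_def')
    next
      case 4
      then have "\<not> leq (\<pi> x) (\<pi> z)"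
        using leq(2)[of "\<pi> y" "\<pi> z"] leq(2)[of "\<pi> x" "\<pi> y"] leq(3) by blast
      with 4 show ?thesis
        by (simp add: m_def')
    qed (simp_all add: m_def')
  qed (simp add: m_def')
  have idem: "m s s = s" for s
    by (simp add: m_def')
  have left_zero: "m a b = a" if "\<pi> a = \<pi> b" for a b
    using that leq(1) by (simp add: m_def')
  have comm: "\<pi> (m a b) = \<pi> (m b a)" for a b
    using leq(2,4) by (auto simp: m_def')
  have below: "leq (\<pi> (m a b)) (\<pi> a)" "leq (\<pi> (m a b)) (\<pi> b)" for a b
    using leq(1,2) by (auto simp: m_def')
  then have below3: "leq (\<pi> (m (m a b) c)) (\<pi> b)" for a b c
    using leq(3) by blast
  have Some_in: "Some x \<in> adj_one X m" if "x \<in> X" for x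
    using that by (auto simp: adj_one_def)
  let ?K = "{(a, b). a \<in> X \<and> b \<in> X \<and> \<pi> a = \<pi> b}"
  have om: "omega X m a = a" if "a \<in> X" for a
    using band_omega[OF sg that idem] .
  have "sim_n X m = ?K"
  proof (intro equalityI subsetI; clarify)
    fix a b assume "(a, b) \<in> sim_n X m"
    then obtain g h where ab: "a \<in> X" "b \<in> X"
      and hag: "mult1 m (mult1 m h (Some a)) g = Some b"
      and gbh: "mult1 m (mult1 m g (Some b)) h = Some a"
      unfolding sim_n_def by blast
    have "leq (\<pi> b) (\<pi> a)"
      using hag below below3 leq(1) by (cases g; cases h) auto
    moreover have "leq (\<pi> a) (\<pi> b)"
      using gbh below below3 leq(1) by (cases g; cases h) auto
    ultimately show "a \<in> X \<and> b \<in> X \<and> \<pi> a = \<pi> b"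
      using ab leq(4) by blast
  next
    fix a b assume "a \<in> X" "b \<in> X" "\<pi> a = \<pi> b"
    then have "\<exists>h\<in>adj_one X m. mult1 m (Some a) (Some a) = mult1 m (Some a) (Some b) \<and>
        mult1 m (Some b) h = mult1 m h (Some a) \<and>
        mult1 m (mult1 m h (Some a)) (Some a) = Some b \<and>
        mult1 m (mult1 m (Some a) (Some b)) h = Some a"
      using Some_in left_zero by (intro bexI[of _ "Some b"]) auto
    with Some_in \<open>a \<in> X\<close> \<open>b \<in> X\<close> show "(a, b) \<in> sim_n X m"
      unfolding sim_n_def by blast
  qed
  moreover have "sim_p X m = ?K"
  proof (intro equalityI subsetI; clarify)
    fix a b assume "(a, b) \<in> sim_p X m"
    then show "a \<in> X \<and> b \<in> X \<and> \<pi> a = \<pi> b"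
      unfolding sim_p_def using comm by auto
  next
    fix a b assume "a \<in> X" "b \<in> X" "\<pi> a = \<pi> b"
    moreover from this have "a = m a b" "b = m b a"
      using left_zero by auto
    ultimately show "(a, b) \<in> sim_p X m"
      unfolding sim_p_def by blast
  qed
  moreover have "sim_tr X m = ?K"
  proof (intro equalityI subsetI; clarify)
    fix a b assume "(a, b) \<in> sim_tr X m"
    then obtain g h where ab: "a \<in> X" "b \<in> X"
      and "mult1 m h g = Some (omega X m a)" "mult1 m g h = Some (omega X m b)"
      unfolding sim_tr_def by blast
    then have "mult1 m h g = Some a" "mult1 m g h = Some b"
      using om by auto
    then show "a \<in> X \<and> b \<in> X \<and> \<pi> a = \<pi> b"
      using ab comm by (cases g; cases h; auto)
  next
    fix a b assume "a \<in> X" "b \<in> X" "\<pi> a = \<pi> b"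
    then have "\<exists>h\<in>adj_one X m. mult1 m (mult1 m (Some b) h) (Some b) = Some b \<and>
        mult1 m (mult1 m h (Some b)) h = h \<and>
        mult1 m h (Some b) = Some (omega X m a) \<and>
        mult1 m (Some b) h = Some (omega X m b) \<and>
        mult1 m (mult1 m (Some b) (Some (m (omega X m a) a))) h = Some (m (omega X m b) b)"
      using Some_in left_zero om by (intro bexI[of _ "Some a"]) auto
    with Some_in \<open>a \<in> X\<close> \<open>b \<in> X\<close> show "(a, b) \<in> sim_tr X m"
      unfolding sim_tr_def by blast
  qed
  ultimately show thesis
    using that[OF band_epigroup[OF sg idem]] by simp
qed


section \<open>Inflations of commutative cancellative semigroups\<close>

definition comm_cancel_semigroup_on :: "'b set \<Rightarrow> ('b \<Rightarrow> 'b \<Rightarrow> 'b) \<Rightarrow> bool" where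
  "comm_cancel_semigroup_on A f \<longleftrightarrow> semigroup_on A f \<and>
     (\<forall>x\<in>A. \<forall>y\<in>A. f x y = f y x) \<and> (\<forall>x\<in>A. \<forall>y\<in>A. \<forall>z\<in>A. f x z = f y z \<longrightarrow> x = y)"

lemma comm_cancel_semigroup_transport:
  assumes h: "bij_betw h A B" and f: "comm_cancel_semigroup_on A f"
  shows "\<exists>f'. comm_cancel_semigroup_on B f'"
proof -
  define k where "k = inv_into A h"
  have k: "k y \<in> A" "h (k y) = y" if "y \<in> B" for y
    using h that unfolding k_def
    by (auto simp: bij_betw_def inv_into_into f_inv_into_f)
  have hk: "h x \<in> B" "k (h x) = x" if "x \<in> A" for x
    using h that unfolding k_def
    by (auto simp: bij_betw_def)
  have f2: "f x y \<in> A" "f x y = f y x" if "x \<in> A" "y \<in> A" for x y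
    using f that unfolding comm_cancel_semigroup_on_def semigroup_on_def by blast+
  have f3: "f (f x y) z = f x (f y z)" "f x z = f y z \<Longrightarrow> x = y"
    if "x \<in> A" "y \<in> A" "z \<in> A" for x y z
    using f that unfolding comm_cancel_semigroup_on_def semigroup_on_def by blast+
  have "comm_cancel_semigroup_on B (\<lambda>x y. h (f (k x) (k y)))"
    unfolding comm_cancel_semigroup_on_def semigroup_on_def
  proof (intro conjI ballI impI)
    fix x y z assume xyz: "x \<in> B" "y \<in> B" "z \<in> B"
    show "h (f (k (h (f (k x) (k y)))) (k z)) = h (f (k x) (k (h (f (k y) (k z)))))"
      using xyz k(1) hk(2) f2(1) f3(1) by simp
    assume "h (f (k x) (k z)) = h (f (k y) (k z))"
    then have "f (k x) (k z) = f (k y) (k z)"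
      using xyz k(1) hk(2) f2(1) by metis
    then show "x = y"
      using xyz k f3(2) by metis
  next
    fix x y assume "x \<in> B" "y \<in> B"
    then show "h (f (k x) (k y)) \<in> B" "h (f (k x) (k y)) = h (f (k y) (k x))"
      using k(1) hk(1) f2 by metis+
  qed
  then show ?thesis
    by blast
qed

text \<open>Integers modulo \<open>n\<close> and, as an infinite set is equipotent to the set of its finite subsets,
  the symmetric difference. Both are groups, except that \<open>n = 0\<close> gives the empty semigroup.\<close>

lemma exists_comm_cancel_semigroup:
  fixes A :: "'b set"
  shows "\<exists>f. comm_cancel_semigroup_on A f"
proof (cases "finite A")
  case True
  let ?n = "card A"
  let ?f = "\<lambda>x y. (x + y) mod ?n"
  have "comm_cancel_semigroup_on {0..<?n} ?f"
    unfolding comm_cancel_semigroup_on_def semigroup_on_def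
  proof (intro conjI ballI impI)
    fix x y z assume xyz: "x \<in> {0..<?n}" "y \<in> {0..<?n}" "z \<in> {0..<?n}"
    show "?f (?f x y) z = ?f x (?f y z)"
      by (simp add: mod_simps add.assoc)
    \<comment> \<open>Residues that agree after adding \<open>z\<close> differ by a multiple of \<open>n\<close> that is less than \<open>n\<close>.\<close>
    have le: "v \<le> u" if "?f u z = ?f v z" "v \<in> {0..<?n}" for u v
    proof (rule ccontr)
      assume "\<not> v \<le> u"
      then have "?n dvd v - u" "0 < v - u" "v - u < ?n"
        using that mod_eq_dvd_iff_nat[of "u + z" "v + z" ?n] by auto
      then show False
        by (simp add: nat_dvd_not_less)
    qed
    assume "?f x z = ?f y z"
    then show "x = y"
      using le[of x y] le[of y x] xyz by simp
  next
    fix x y assume "x \<in> {0..<?n}" "y \<in> {0..<?n}"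
    then have "0 < ?n"
      by simp
    then show "?f x y \<in> {0..<?n}" "?f x y = ?f y x"
      by (simp_all add: add.commute)
  qed
  moreover obtain h where "bij_betw h {0..<?n} A"
    using ex_bij_betw_nat_finite[OF True] by blast
  ultimately show ?thesis
    using comm_cancel_semigroup_transport by blast
next
  case False
  let ?f = "\<lambda>x y :: 'b set. (x - y) \<union> (y - x)"
  have "comm_cancel_semigroup_on (Fpow A) ?f"
    unfolding comm_cancel_semigroup_on_def semigroup_on_def
  proof (intro conjI ballI impI)
    fix x y z :: "'b set"
    show "?f (?f x y) z = ?f x (?f y z)" "?f x y = ?f y x"
      by blast+
    show "x = y" if "?f x z = ?f y z"
      using that by blast
    show "?f x y \<in> Fpow A" if "x \<in> Fpow A" "y \<in> Fpow A"
      using that by (auto simp: Fpow_def)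
  qed
  moreover obtain h where "bij_betw h (Fpow A) A"
    using Fpow_infinite_bij_betw[OF False] by blast
  ultimately show ?thesis
    using comm_cancel_semigroup_transport by blast
qed

text \<open>\<open>X\<close> is an inflation of a copy of the semigroup on \<open>\<pi> ` X\<close>: all products are representatives
  of fibres, chosen by \<open>r\<close>, and depend only on the fibres of their factors. By commutativity
  \<open>ag = gb\<close> reads \<open>\<pi> a \<pi> g = \<pi> b \<pi> g\<close>, so cancellation gives one direction for \<open>\<sim>\<^sub>o\<close>, and the choice
  \<open>g = h = a\<close> the other. A zero \<open>z\<close> would make all \<open>\<pi> x \<pi> z\<close> equal and thus leave only one
  fibre.\<close>

lemma inflation_covers:
  fixes X :: "'a set" and \<pi> :: "'a \<Rightarrow> 'b"
  obtains m where "semigroup_on X m"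
    "sim_o X m = {(a, b). a \<in> X \<and> b \<in> X \<and> \<pi> a = \<pi> b}"
    "(\<exists>z. is_zero X m z) \<longrightarrow> (\<forall>a\<in>X. \<forall>b\<in>X. \<pi> a = \<pi> b)"
proof -
  obtain f where f: "comm_cancel_semigroup_on (\<pi> ` X) f"
    using exists_comm_cancel_semigroup by blast
  define r where "r = inv_into X \<pi>"
  have r: "r p \<in> X" "\<pi> (r p) = p" if "p \<in> \<pi> ` X" for p
    using that by (simp_all add: r_def inv_into_into f_inv_into_f)
  define m where "m x y = r (f (\<pi> x) (\<pi> y))" for x y
  have closed: "f (\<pi> x) (\<pi> y) \<in> \<pi> ` X" if "x \<in> X" "y \<in> X" for x y
    using f that by (auto simp: comm_cancel_semigroup_on_def semigroup_on_def)
  have comm: "f (\<pi> x) (\<pi> y) = f (\<pi> y) (\<pi> x)" if "x \<in> X" "y \<in> X" for x y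
    using f that by (auto simp: comm_cancel_semigroup_on_def)
  have cancel: "\<pi> x = \<pi> y"
    if "f (\<pi> x) (\<pi> z) = f (\<pi> y) (\<pi> z)" "x \<in> X" "y \<in> X" "z \<in> X" for x y z
    using f that unfolding comm_cancel_semigroup_on_def by blast
  have m: "m x y \<in> X" "\<pi> (m x y) = f (\<pi> x) (\<pi> y)" if "x \<in> X" "y \<in> X" for x y
    using closed[OF that] r by (auto simp: m_def)
  have sg: "semigroup_on X m"
    unfolding semigroup_on_def
  proof (intro conjI ballI)
    fix x y z assume xyz: "x \<in> X" "y \<in> X" "z \<in> X"
    have "f (f (\<pi> x) (\<pi> y)) (\<pi> z) = f (\<pi> x) (f (\<pi> y) (\<pi> z))"
      using f xyz by (simp add: comm_cancel_semigroup_on_def semigroup_on_def)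
    then show "m (m x y) z = m x (m y z)"
      using m(2) xyz by (simp add: m_def)
  qed (use m in auto)
  have "sim_o X m = {(a, b). a \<in> X \<and> b \<in> X \<and> \<pi> a = \<pi> b}"
  proof (intro equalityI subsetI; clarify)
    fix a b assume "(a, b) \<in> sim_o X m"
    then obtain g where "a \<in> X" "b \<in> X" "g \<in> X" "m a g = m g b"
      by (auto simp: sim_o_def)
    then show "a \<in> X \<and> b \<in> X \<and> \<pi> a = \<pi> b"
      using m(2) comm cancel by metis
  next
    fix a b assume "a \<in> X" "b \<in> X" "\<pi> a = \<pi> b"
    then show "(a, b) \<in> sim_o X m"
      by (auto simp: sim_o_def m_def)
  qed
  moreover have "\<pi> a = \<pi> b" if "is_zero X m z" "a \<in> X" "b \<in> X" for z a b
  proof -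
    have "m a z = m b z" and "z \<in> X"
      using that by (auto simp: is_zero_def)
    then show ?thesis
      using that m(2) cancel by metis
  qed
  ultimately show thesis
    by (intro that[OF sg]) blast+
qed


section \<open>The relation \<open>\<sim>\<^sub>c\<close>\<close>

lemma sim_c_refl: "Id_on X \<subseteq> sim_c X m"
proof clarify
  fix a assume "a \<in> X"
  then have "Some a \<in> adj_one X m"
    by (auto simp: adj_one_def)
  then have "mult1 m (Some a) (one1 X m) = mult1 m (one1 X m) (Some a)"
    using one1_is_identity[of X m] by (simp add: is_identity_def)
  moreover have "one1 X m \<in> PP1 X m a"
    by (simp add: PP1_def)
  ultimately show "(a, a) \<in> sim_c X m"
    using \<open>a \<in> X\<close> unfolding sim_c_def by blast
qed

text \<open>Without a zero the conjugators of \<open>\<sim>\<^sub>c\<close> range over all of \<open>X\<^sup>1\<close>, and a conjugator \<open>1\<close> is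
  possible only between equal elements.\<close>

lemma sim_c_no_zero:
  assumes "\<nexists>z. is_zero X m z"
  shows "sim_c X m = sim_o X m \<union> Id_on X"
proof
  have PP1: "PP1 X m a = insert (one1 X m) (Some ` X)" for a
    using assms by (simp add: PP1_def PP_def)
  show "sim_o X m \<union> Id_on X \<subseteq> sim_c X m"
    using sim_c_refl[of X m] by (auto simp: sim_o_def sim_c_def PP1)
  show "sim_c X m \<subseteq> sim_o X m \<union> Id_on X"
  proof clarify
    fix a b assume c: "(a, b) \<in> sim_c X m" and "(a, b) \<notin> Id_on X"
    then have ab: "a \<in> X" "b \<in> X" "a \<noteq> b"
      by (auto simp: sim_c_def)
    from c obtain g h where
      gh: "g \<in> insert (one1 X m) (Some ` X)" "h \<in> insert (one1 X m) (Some ` X)"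
      and eq: "mult1 m (Some a) g = mult1 m g (Some b)" "mult1 m (Some b) h = mult1 m h (Some a)"
      unfolding sim_c_def PP1 by blast
    have "Some x \<in> adj_one X m" if "x \<in> X" for x
      using that by (auto simp: adj_one_def)
    then have "mult1 m (one1 X m) (Some x) = Some x" "mult1 m (Some x) (one1 X m) = Some x"
      if "x \<in> X" for x
      using that one1_is_identity[of X m] by (auto simp: is_identity_def)
    then have "g \<in> Some ` X" "h \<in> Some ` X"
      using gh eq ab by auto
    then show "(a, b) \<in> sim_o X m"
      using ab eq by (auto simp: sim_o_def)
  qed
qed

text \<open>The one-element semigroup needs separate treatment throughout, as its only element is a
  zero; there \<open>\<sim>\<^sub>c\<close> is equality. An inflation of the trivial group over a larger set is no use:
  it has zero products, so that \<open>\<sim>\<^sub>c\<close> is equality again, and the left zero semigroup replaces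
  it.\<close>

lemma sim_c_covers:
  fixes X :: "'a set" and \<pi> :: "'a \<Rightarrow> 'b"
  shows "\<exists>m. semigroup_on X m \<and> sim_c X m = {(a, b). a \<in> X \<and> b \<in> X \<and> \<pi> a = \<pi> b}"
proof (cases "\<forall>a\<in>X. \<forall>b\<in>X. \<pi> a = \<pi> b")
  case True
  define m :: "'a \<Rightarrow> 'a \<Rightarrow> 'a" where "m x y = x" for x y
  have sg: "semigroup_on X m"
    by (simp add: semigroup_on_def m_def)
  have "sim_c X m = X \<times> X"
  proof (cases "\<exists>z. is_zero X m z")
    case True
    then obtain z where "X = {z}"
      by (auto simp: is_zero_def m_def)
    moreover have "sim_c X m \<subseteq> X \<times> X"
      by (auto simp: sim_c_def)
    ultimately show ?thesis
      using sim_c_refl[of X m] by auto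
  next
    case False
    moreover have "sim_o X m = X \<times> X"
      by (auto simp: sim_o_def m_def)
    ultimately show ?thesis
      using sim_c_no_zero[of X m] by auto
  qed
  moreover have "X \<times> X = {(a, b). a \<in> X \<and> b \<in> X \<and> \<pi> a = \<pi> b}"
    using True by blast
  ultimately show ?thesis
    using sg by blast
next
  case False
  obtain m where m: "semigroup_on X m"
    "sim_o X m = {(a, b). a \<in> X \<and> b \<in> X \<and> \<pi> a = \<pi> b}"
    "(\<exists>z. is_zero X m z) \<longrightarrow> (\<forall>a\<in>X. \<forall>b\<in>X. \<pi> a = \<pi> b)"
    by (rule inflation_covers[of X \<pi>])
  then have "\<nexists>z. is_zero X m z"
    using False by blast
  then have "sim_c X m = {(a, b). a \<in> X \<and> b \<in> X \<and> \<pi> a = \<pi> b}"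
    unfolding sim_c_no_zero[OF \<open>\<nexists>z. is_zero X m z\<close>] m(2) by blast
  then show ?thesis
    using m(1) by blast
qed


section \<open>All six relations\<close>

theorem theorem3p3:
  shows "partition_covering semigroup_on (sim_o :: 'a set \<Rightarrow> ('a \<Rightarrow> 'a \<Rightarrow> 'a) \<Rightarrow> 'a rel) \<and>
         partition_covering semigroup_on (sim_c :: 'a set \<Rightarrow> ('a \<Rightarrow> 'a \<Rightarrow> 'a) \<Rightarrow> 'a rel) \<and>
         partition_covering semigroup_on (sim_n :: 'a set \<Rightarrow> ('a \<Rightarrow> 'a \<Rightarrow> 'a) \<Rightarrow> 'a rel) \<and>
         partition_covering semigroup_on (sim_p :: 'a set \<Rightarrow> ('a \<Rightarrow> 'a \<Rightarrow> 'a) \<Rightarrow> 'a rel) \<and>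
         partition_covering semigroup_on (sim_p_star :: 'a set \<Rightarrow> ('a \<Rightarrow> 'a \<Rightarrow> 'a) \<Rightarrow> 'a rel) \<and>
         partition_covering epigroup (sim_tr :: 'a set \<Rightarrow> ('a \<Rightarrow> 'a \<Rightarrow> 'a) \<Rightarrow> 'a rel)"
proof (intro conjI; rule partition_coveringI)
  fix X :: "'a set" and \<pi> :: "'a \<Rightarrow> 'a set"
  let ?K = "{(a, b). a \<in> X \<and> b \<in> X \<and> \<pi> a = \<pi> b}"
  show "\<exists>m. semigroup_on X m \<and> sim_o X m = ?K"
    by (rule inflation_covers[of X \<pi>]) blast
  show "\<exists>m. semigroup_on X m \<and> sim_c X m = ?K"
    by (rule sim_c_covers)
  obtain m where m: "epigroup X m" "sim_n X m = ?K" "sim_p X m = ?K" "sim_tr X m = ?K"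
    by (rule left_zero_chain_covers[of X \<pi>])
  then have sg: "semigroup_on X m"
    by (simp add: epigroup_def)
  show "\<exists>m. semigroup_on X m \<and> sim_n X m = ?K" "\<exists>m. semigroup_on X m \<and> sim_p X m = ?K"
    "\<exists>m. epigroup X m \<and> sim_tr X m = ?K"
    using m sg by blast+
  have "trans ?K"
    by (auto intro!: transI)
  then show "\<exists>m. semigroup_on X m \<and> sim_p_star X m = ?K"
    using m(3) sg by (auto simp: sim_p_star_def)
qed

end
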